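(* Let $(K,\rho)$ be a complete metric space that is not a singleton. If $K$ is spreadingly local (in particular, if $K$ is metrically convex, or if $K$ is compact and local), then the Banach space $\mathrm{Lip}(K)$ has the Daugavet property.
   Context: For a metric space $(K,\rho)$, the space of all Lipschitz functions $f\colon K\to\mathbb{R}$ carries the seminorm $$\|f\|=\sup\Bigl\{\frac{|f(t_1)-f(t_2)|}{\rho(t_1,t_2)} : t_1\neq t_2\in K\Bigr\}.$$ $\mathrm{Lip}(K)$ denotes the Banach space obtained by quotienting out the constant functions (the kernel of the seminorm), with the induced norm, also denoted $\|\cdot\|$. Elements of $\mathrm{Lip}(K)$ are referred to as functions. A Banach space $X$ has the Daugavet property if $\|\mathrm{Id}+T\|=1+\|T\|$ for every bounded rank-1 operator $T\colon X\to X$. $K$ is called metrically convex if for any two points $t_1,t_2\in K$ and radii $r_1,r_2\ge 0$, the closed balls $B_K(t_1,r_1)$ and $B_K(t_2,r_2)$ intersect if and only if $\rho(t_1,t_2)\le r_1+r_2$. $K$ is called local if for every $\varepsilon>0$ and every $f\in\mathrm{Lip}(K)$ there are two distinct points $\tau_1,\tau_2\in K$ such that $\rho(\tau_1,\tau_2)<\varepsilon$ and $$\frac{f(\tau_2)-f(\tau_1)}{\rho(\tau_1,\tau_2)}>\|f\|-\varepsilon. \qquad ( * )$$ For $f\in\mathrm{Lip}(K)$ and $\varepsilon>0$, a point $t\in K$ is an $\varepsilon$-point of $f$ if in every neighbourhood $U\subset K$ of $t$ there are two distinct points $\tau_1,\tau_2\in U$ for which $( * )$ holds. $K$ is called spreadingly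 local if for every $\varepsilon>0$ and every $f\in\mathrm{Lip}(K)$ there are infinitely many $\varepsilon$-points of $f$. *)

theory Defs
  imports "HOL-Analysis.Analysis"
begin

definition lipschitz_fun :: "('a::metric_space \<Rightarrow> real) \<Rightarrow> bool" where
  "lipschitz_fun f \<longleftrightarrow> (\<exists>C. C-lipschitz_on UNIV f)"

text \<open>The inserted \<open>0\<close> only matters on a one-point space, where the supremum would
  range over the empty set and \<open>Sup\<close> on the reals is unspecified.\<close>

definition lip_seminorm :: "('a::metric_space \<Rightarrow> real) \<Rightarrow> real" where
  "lip_seminorm f =
     Sup (insert 0 {\<bar>f t1 - f t2\<bar> / dist t1 t2 | t1 t2. t1 \<noteq> t2})"

text \<open>Equality modulo constants; relating only Lipschitz functions makes \<open>lip\<close> below the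
  quotient of the Lipschitz functions (rather than of all functions).\<close>

definition lip_eq :: "('a::metric_space \<Rightarrow> real) \<Rightarrow> ('a \<Rightarrow> real) \<Rightarrow> bool" where
  "lip_eq f g \<longleftrightarrow> lipschitz_fun f \<and> lipschitz_fun g \<and> (\<exists>c. \<forall>t. f t = g t + c)"

lemma lipschitz_funE:
  assumes "lipschitz_fun f"
  obtains C where "C \<ge> 0" "\<And>s t. \<bar>f s - f t\<bar> \<le> C * dist s t"
proof -
  from assms obtain C where "C-lipschitz_on UNIV f"
    unfolding lipschitz_fun_def by blast
  then have "C \<ge> 0" "\<And>s t. \<bar>f s - f t\<bar> \<le> C * dist s t"
    by (auto simp: lipschitz_on_def dist_real_def)
  then show ?thesis by (rule that)
qed

lemma lipschitz_funI:
  assumes "C \<ge> 0" "\<And>s t. \<bar>f s - f t\<bar> \<le> C * dist s t"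
  shows "lipschitz_fun f"
  using assms unfolding lipschitz_fun_def lipschitz_on_def dist_real_def by blast

lemma lipschitz_fun_zero: "lipschitz_fun (\<lambda>_. 0)"
  by (rule lipschitz_funI[of 0]) auto

lemma lipschitz_fun_add:
  assumes "lipschitz_fun f" "lipschitz_fun g"
  shows "lipschitz_fun (\<lambda>t. f t + g t)"
proof -
  obtain C where C: "C \<ge> 0" "\<And>s t. \<bar>f s - f t\<bar> \<le> C * dist s t"
    using assms(1) by (rule lipschitz_funE) blast
  obtain D where D: "D \<ge> 0" "\<And>s t. \<bar>g s - g t\<bar> \<le> D * dist s t"
    using assms(2) by (rule lipschitz_funE) blast
  show ?thesis
  proof (rule lipschitz_funI[of "C + D"])
    fix s t
    show "\<bar>f s + g s - (f t + g t)\<bar> \<le> (C + D) * dist s t"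
      using C(2)[of s t] D(2)[of s t] by (simp add: distrib_right)
  qed (use C D in auto)
qed

lemma lipschitz_fun_scale:
  assumes "lipschitz_fun f"
  shows "lipschitz_fun (\<lambda>t. a * f t)"
proof -
  obtain C where C: "C \<ge> 0" "\<And>s t. \<bar>f s - f t\<bar> \<le> C * dist s t"
    using assms by (rule lipschitz_funE) blast
  show ?thesis
  proof (rule lipschitz_funI[of "\<bar>a\<bar> * C"])
    fix s t
    have "\<bar>a * f s - a * f t\<bar> = \<bar>a\<bar> * \<bar>f s - f t\<bar>"
      by (metis abs_mult right_diff_distrib)
    also have "\<dots> \<le> \<bar>a\<bar> * (C * dist s t)"
      by (intro mult_left_mono C(2)) auto
    finally show "\<bar>a * f s - a * f t\<bar> \<le> \<bar>a\<bar> * C * dist s t"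
      by (simp add: mult.assoc)
  qed (use C in auto)
qed

lemma part_equivp_lip_eq: "part_equivp (lip_eq :: ('a::metric_space \<Rightarrow> real) \<Rightarrow> _)"
proof (rule part_equivpI)
  show "\<exists>f :: 'a \<Rightarrow> real. lip_eq f f"
    by (rule exI[of _ "\<lambda>_. 0"]) (auto simp: lip_eq_def lipschitz_fun_zero)
  show "symp (lip_eq :: ('a \<Rightarrow> real) \<Rightarrow> _)"
  proof (rule sympI)
    fix f g :: "'a \<Rightarrow> real"
    assume "lip_eq f g"
    then obtain c where "lipschitz_fun f" "lipschitz_fun g" "\<And>t. f t = g t + c"
      unfolding lip_eq_def by blast
    then show "lip_eq g f"
      unfolding lip_eq_def by (intro conjI exI[of _ "-c"]) auto
  qed
  show "transp (lip_eq :: ('a \<Rightarrow> real) \<Rightarrow> _)"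
  proof (rule transpI)
    fix f g h :: "'a \<Rightarrow> real"
    assume "lip_eq f g" "lip_eq g h"
    then obtain c d where "lipschitz_fun f" "lipschitz_fun h"
      "\<And>t. f t = g t + c" "\<And>t. g t = h t + d"
      unfolding lip_eq_def by blast
    then show "lip_eq f h"
      unfolding lip_eq_def by (intro conjI exI[of _ "c + d"]) auto
  qed
qed

quotient_type (overloaded) 'a lip = "'a::metric_space \<Rightarrow> real" / partial: lip_eq
  by (rule part_equivp_lip_eq)

text \<open>\<open>lip_incr f s t\<close> is \<open>f(t) - f(s)\<close>, which does not depend on the representative.\<close>

lift_definition lip_incr :: "'a::metric_space lip \<Rightarrow> 'a \<Rightarrow> 'a \<Rightarrow> real"
  is "\<lambda>f s t. f t - f s"
  by (auto simp: lip_eq_def fun_eq_iff)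

lemma lip_incr_eqI:
  assumes "\<And>s t. lip_incr f s t = lip_incr g s t"
  shows "f = g"
  using assms
proof transfer
  fix f g :: "'a \<Rightarrow> real"
  assume l: "lip_eq f f" "lip_eq g g" and eq: "\<And>s t. f t - f s = g t - g s"
  have "f t = g t + (f undefined - g undefined)" for t
    using eq[of t undefined] by simp
  then show "lip_eq f g"
    using l unfolding lip_eq_def by blast
qed

lemma lip_incr_surj:
  assumes "lipschitz_fun F"
  obtains f where "\<And>s t. lip_incr f s t = F t - F s"
proof -
  have "lip_eq F F" using assms unfolding lip_eq_def by auto
  then have "\<And>s t. lip_incr (abs_lip F) s t = F t - F s"
    by (simp add: lip_incr.abs_eq)
  then show ?thesis by (rule that)
qed

instantiation lip :: (metric_space) real_vector
begin

lift_definition zero_lip :: "'a lip" is "\<lambda>_. 0"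
  by (auto simp: lip_eq_def lipschitz_fun_zero)

lift_definition plus_lip :: "'a lip \<Rightarrow> 'a lip \<Rightarrow> 'a lip" is "\<lambda>f g t. f t + g t"
proof -
  fix f f' g g' :: "'a \<Rightarrow> real"
  assume "lip_eq f f'" "lip_eq g g'"
  then obtain c d where "lipschitz_fun f" "lipschitz_fun f'" "lipschitz_fun g" "lipschitz_fun g'"
    "\<And>t. f t = f' t + c" "\<And>t. g t = g' t + d"
    unfolding lip_eq_def by blast
  then show "lip_eq (\<lambda>t. f t + g t) (\<lambda>t. f' t + g' t)"
    unfolding lip_eq_def
    by (intro conjI exI[of _ "c + d"]) (blast intro: lipschitz_fun_add | simp)+
qed

lift_definition scaleR_lip :: "real \<Rightarrow> 'a lip \<Rightarrow> 'a lip" is "\<lambda>a f t. a * f t"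
proof -
  fix a :: real and f f' :: "'a \<Rightarrow> real"
  assume "lip_eq f f'"
  then obtain c where "lipschitz_fun f" "lipschitz_fun f'" "\<And>t. f t = f' t + c"
    unfolding lip_eq_def by blast
  then show "lip_eq (\<lambda>t. a * f t) (\<lambda>t. a * f' t)"
    unfolding lip_eq_def
    by (intro conjI exI[of _ "a * c"]) (blast intro: lipschitz_fun_scale | simp add: distrib_left)+
qed

definition uminus_lip :: "'a lip \<Rightarrow> 'a lip" where "uminus_lip f = (-1) *\<^sub>R f"

definition minus_lip :: "'a lip \<Rightarrow> 'a lip \<Rightarrow> 'a lip" where "minus_lip f g = f + (- g)"

lemma lip_incr_simps_aux:
  "lip_incr (0::'a lip) s t = 0"
  "lip_incr (f + g) s t = lip_incr f s t + lip_incr g s t"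
  "lip_incr (a *\<^sub>R f) s t = a * lip_incr f s t"
  by (transfer, simp add: algebra_simps)+

lemma lip_incr_simps_aux':
  "lip_incr (- f) s t = - lip_incr f s t"
  "lip_incr (f - g) s t = lip_incr f s t - lip_incr g s t"
  by (simp_all add: lip_incr_simps_aux uminus_lip_def minus_lip_def)

instance
  by standard
    (rule lip_incr_eqI, simp add: lip_incr_simps_aux lip_incr_simps_aux' algebra_simps)+

end

lemmas lip_incr_simps [simp] = lip_incr_simps_aux lip_incr_simps_aux'

instantiation lip :: (metric_space) real_normed_vector
begin

lift_definition norm_lip :: "'a lip \<Rightarrow> real" is lip_seminorm
proof -
  fix f g :: "'a \<Rightarrow> real"
  assume "lip_eq f g"
  then obtain c where "\<And>t. f t = g t + c" unfolding lip_eq_def by blast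
  then show "lip_seminorm f = lip_seminorm g" unfolding lip_seminorm_def by simp
qed

definition sgn_lip :: "'a lip \<Rightarrow> 'a lip" where "sgn_lip f = f /\<^sub>R norm f"

definition dist_lip :: "'a lip \<Rightarrow> 'a lip \<Rightarrow> real" where "dist_lip f g = norm (f - g)"

definition uniformity_lip :: "('a lip \<times> 'a lip) filter" where
  "uniformity_lip = (INF e\<in>{0<..}. principal {(f, g). dist f g < e})"

definition open_lip :: "'a lip set \<Rightarrow> bool" where
  "open_lip U \<longleftrightarrow> (\<forall>f\<in>U. eventually (\<lambda>(f', g). f' = f \<longrightarrow> g \<in> U) uniformity)"

lemma lip_incr_le_aux: "\<bar>lip_incr f s t\<bar> \<le> norm f * dist s t"
proof transfer
  fix f :: "'a \<Rightarrow> real" and s t :: 'a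
  assume "lip_eq f f"
  then have "lipschitz_fun f" by (simp add: lip_eq_def)
  then obtain C where C: "C \<ge> 0" "\<And>s t. \<bar>f s - f t\<bar> \<le> C * dist s t"
    by (rule lipschitz_funE) blast
  let ?S = "insert 0 {\<bar>f t1 - f t2\<bar> / dist t1 t2 | t1 t2. t1 \<noteq> t2}"
  have "bdd_above ?S"
    by (rule bdd_aboveI[of _ C]) (auto simp: C divide_le_eq)
  then have "\<bar>f s - f t\<bar> / dist s t \<le> lip_seminorm f" if "s \<noteq> t"
    unfolding lip_seminorm_def using that by (intro cSup_upper) auto
  then show "\<bar>f t - f s\<bar> \<le> lip_seminorm f * dist s t"
    by (cases "s = t") (auto simp: divide_le_eq abs_minus_commute)
qed

lemma norm_lip_le_aux:
  assumes "C \<ge> 0" "\<And>s t. \<bar>lip_incr f s t\<bar> \<le> C * dist s t"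
  shows "norm f \<le> C"
  using assms
proof transfer
  fix C :: real and f :: "'a \<Rightarrow> real"
  assume C: "C \<ge> 0" "\<And>s t. \<bar>f t - f s\<bar> \<le> C * dist s t"
  show "lip_seminorm f \<le> C"
    unfolding lip_seminorm_def
  proof (rule cSup_least)
    fix x
    assume "x \<in> insert 0 {\<bar>f t1 - f t2\<bar> / dist t1 t2 | t1 t2. t1 \<noteq> t2}"
    then show "x \<le> C"
      using C(1) C(2) by (auto simp: divide_le_eq) (metis C(2) dist_commute)
  qed auto
qed

lemma norm_lip_nonneg_aux: "norm (f :: 'a lip) \<ge> 0"
proof transfer
  fix f :: "'a \<Rightarrow> real"
  assume "lip_eq f f"
  then have "lipschitz_fun f" by (simp add: lip_eq_def)
  then obtain C where C: "C \<ge> 0" "\<And>s t. \<bar>f s - f t\<bar> \<le> C * dist s t"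
    by (rule lipschitz_funE) blast
  have "bdd_above (insert 0 {\<bar>f t1 - f t2\<bar> / dist t1 t2 | t1 t2. t1 \<noteq> t2})"
    by (rule bdd_aboveI[of _ C]) (auto simp: C divide_le_eq)
  then show "0 \<le> lip_seminorm f"
    unfolding lip_seminorm_def by (intro cSup_upper) auto
qed

lemma norm_scale_le_aux: "norm (a *\<^sub>R f) \<le> \<bar>a\<bar> * norm (f :: 'a lip)"
proof (rule norm_lip_le_aux)
  fix s t
  have "\<bar>lip_incr (a *\<^sub>R f) s t\<bar> = \<bar>a\<bar> * \<bar>lip_incr f s t\<bar>"
    by (simp add: abs_mult)
  also have "\<dots> \<le> \<bar>a\<bar> * (norm f * dist s t)"
    by (intro mult_left_mono lip_incr_le_aux) auto
  finally show "\<bar>lip_incr (a *\<^sub>R f) s t\<bar> \<le> \<bar>a\<bar> * norm f * dist s t"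
    by (simp add: mult.assoc)
qed (simp add: norm_lip_nonneg_aux)

instance
proof
  fix f g :: "'a lip" and a :: real
  show "dist f g = norm (f - g)" by (rule dist_lip_def)
  show "sgn f = f /\<^sub>R norm f" by (rule sgn_lip_def)
  show "uniformity = (INF e\<in>{0<..}. principal {(x, y::'a lip). dist x y < e})"
    by (rule uniformity_lip_def)
  show "open U = (\<forall>x\<in>U. \<forall>\<^sub>F (x', y) in uniformity. x' = x \<longrightarrow> y \<in> U)" for U :: "'a lip set"
    by (rule open_lip_def)
  show "norm f = 0 \<longleftrightarrow> f = 0"
  proof
    assume "norm f = 0"
    then have "lip_incr f s t = 0" for s t
      using lip_incr_le_aux[of f s t] by simp
    then show "f = 0" by (intro lip_incr_eqI) simp
  next
    assume "f = 0"
    then show "norm f = 0"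
      using norm_lip_le_aux[of 0 f] norm_lip_nonneg_aux[of f] by simp
  qed
  show "norm (f + g) \<le> norm f + norm g"
  proof (rule norm_lip_le_aux)
    fix s t
    show "\<bar>lip_incr (f + g) s t\<bar> \<le> (norm f + norm g) * dist s t"
      using lip_incr_le_aux[of f s t] lip_incr_le_aux[of g s t]
      by (simp add: distrib_right)
  qed (simp add: norm_lip_nonneg_aux)
  show "norm (a *\<^sub>R f) = \<bar>a\<bar> * norm f"
  proof (cases "a = 0")
    case True
    then show ?thesis
      using norm_scale_le_aux[of a f] norm_lip_nonneg_aux[of "a *\<^sub>R f"] by simp
  next
    case False
    have "norm f = norm (inverse a *\<^sub>R (a *\<^sub>R f))" using False by simp
    also have "\<dots> \<le> \<bar>inverse a\<bar> * norm (a *\<^sub>R f)" by (rule norm_scale_le_aux)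
    finally have "\<bar>a\<bar> * norm f \<le> norm (a *\<^sub>R f)"
      using False by (simp add: field_simps)
    then show ?thesis using norm_scale_le_aux[of a f] by simp
  qed
qed

end

lemmas lip_incr_le = lip_incr_le_aux
lemmas norm_lip_le = norm_lip_le_aux

instance lip :: (metric_space) banach
proof
  fix X :: "nat \<Rightarrow> 'a lip"
  assume X: "Cauchy X"
  define z :: 'a where "z = undefined"
  define F where "F n t = lip_incr (X n) z t" for n t
  have incr: "lip_incr f s t = lip_incr f z t - lip_incr f z s" for f :: "'a lip" and s t
    by transfer simp
  have bound: "\<bar>(F n t - F n s) - (F m t - F m s)\<bar> \<le> norm (X n - X m) * dist s t" for n m s t
    using lip_incr_le[of "X n - X m" s t] by (simp add: F_def incr[of _ s t])
  have F0: "F n z = 0" for n unfolding F_def by transfer simp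
  have "convergent (\<lambda>n. F n t)" for t
  proof (rule real_Cauchy_convergent, rule metric_CauchyI)
    fix e :: real assume "e > 0"
    then have "e / (dist z t + 1) > 0" by (simp add: add_nonneg_pos)
    then obtain N where N: "\<And>m n. m \<ge> N \<Longrightarrow> n \<ge> N \<Longrightarrow> norm (X m - X n) < e / (dist z t + 1)"
      using X unfolding Cauchy_iff by blast
    show "\<exists>M. \<forall>m\<ge>M. \<forall>n\<ge>M. dist (F m t) (F n t) < e"
    proof (intro exI[of _ N] allI impI)
      fix m n assume "m \<ge> N" "n \<ge> N"
      have "\<bar>F m t - F n t\<bar> \<le> norm (X m - X n) * dist z t"
        using bound[of m t z n] by (simp add: F0)
      also have "\<dots> \<le> norm (X m - X n) * (dist z t + 1)"
        by (intro mult_left_mono) auto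
      also have "\<dots> < e"
        using N[OF \<open>m \<ge> N\<close> \<open>n \<ge> N\<close>] by (simp add: pos_less_divide_eq add_nonneg_pos)
      finally show "dist (F m t) (F n t) < e" by (simp add: dist_real_def)
    qed
  qed
  then obtain G where G: "\<And>t. (\<lambda>n. F n t) \<longlonglongrightarrow> G t"
    unfolding convergent_def by metis
  obtain B where B: "\<And>n. norm (X n) \<le> B"
    using Cauchy_Bseq[OF X] unfolding Bseq_def by blast
  have "lipschitz_fun G"
  proof (rule lipschitz_funI)
    show "B \<ge> 0" using B[of 0] norm_ge_zero[of "X 0"] by linarith
    fix s t
    have "\<bar>F n s - F n t\<bar> \<le> B * dist s t" for n
    proof -
      have "\<bar>F n s - F n t\<bar> \<le> norm (X n) * dist s t"
        using lip_incr_le[of "X n" s t] by (simp add: F_def incr[of _ s t] abs_minus_commute)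
      also have "\<dots> \<le> B * dist s t" by (intro mult_right_mono B) auto
      finally show ?thesis .
    qed
    moreover have "(\<lambda>n. \<bar>F n s - F n t\<bar>) \<longlonglongrightarrow> \<bar>G s - G t\<bar>"
      by (intro tendsto_intros G)
    ultimately show "\<bar>G s - G t\<bar> \<le> B * dist s t"
      by (intro LIMSEQ_le_const2) auto
  qed
  then obtain L where L: "\<And>s t. lip_incr L s t = G t - G s"
    by (rule lip_incr_surj) blast
  have "X \<longlonglongrightarrow> L"
  proof (rule LIMSEQ_I)
    fix e :: real assume "e > 0"
    then have "e / 2 > 0" by simp
    then obtain N where N: "\<And>m n. m \<ge> N \<Longrightarrow> n \<ge> N \<Longrightarrow> norm (X m - X n) < e / 2"
      using X unfolding Cauchy_iff by blast
    show "\<exists>N. \<forall>n\<ge>N. norm (X n - L) < e"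
    proof (intro exI[of _ N] allI impI)
      fix n assume n: "n \<ge> N"
      have "norm (X n - L) \<le> e / 2"
      proof (rule norm_lip_le)
        fix s t
        have "\<bar>(F n t - F n s) - (F m t - F m s)\<bar> \<le> e / 2 * dist s t" if "m \<ge> N" for m
        proof -
          have "norm (X n - X m) * dist s t \<le> e / 2 * dist s t"
            using N[OF n that] by (intro mult_right_mono) auto
          with bound[of n t s m] show ?thesis by linarith
        qed
        moreover have "(\<lambda>m. \<bar>(F n t - F n s) - (F m t - F m s)\<bar>)
            \<longlonglongrightarrow> \<bar>(F n t - F n s) - (G t - G s)\<bar>"
          by (intro tendsto_intros G)
        ultimately have "\<bar>(F n t - F n s) - (G t - G s)\<bar> \<le> e / 2 * dist s t"
          by (intro LIMSEQ_le_const2) auto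
        then show "\<bar>lip_incr (X n - L) s t\<bar> \<le> e / 2 * dist s t"
          by (simp add: L F_def incr[of "X n" s t])
      qed (use \<open>e > 0\<close> in simp)
      then show "norm (X n - L) < e" using \<open>e > 0\<close> by linarith
    qed
  qed
  then show "convergent X" unfolding convergent_def by blast
qed

text \<open>\<open>dim\<close> is \<open>0\<close> on infinite-dimensional subspaces, so \<open>dim (range T) = 1\<close> holds
  exactly for operators of rank one.\<close>

definition daugavet_property :: "'x::banach itself \<Rightarrow> bool" where
  "daugavet_property TYPE('x) \<longleftrightarrow>
     (\<forall>T :: 'x \<Rightarrow>\<^sub>L 'x. dim (range (blinfun_apply T)) = 1 \<longrightarrow>
        norm (id_blinfun + T) = 1 + norm T)"

definition metrically_convex :: "'a::metric_space itself \<Rightarrow> bool" where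
  "metrically_convex TYPE('a) \<longleftrightarrow>
     (\<forall>(t1::'a) t2 r1 r2. r1 \<ge> 0 \<longrightarrow> r2 \<ge> 0 \<longrightarrow>
        (cball t1 r1 \<inter> cball t2 r2 \<noteq> {} \<longleftrightarrow> dist t1 t2 \<le> r1 + r2))"

definition local_space :: "'a::metric_space itself \<Rightarrow> bool" where
  "local_space TYPE('a) \<longleftrightarrow>
     (\<forall>\<epsilon>>0. \<forall>f :: 'a lip. \<exists>\<tau>1 \<tau>2. \<tau>1 \<noteq> \<tau>2 \<and> dist \<tau>1 \<tau>2 < \<epsilon> \<and>
        lip_incr f \<tau>1 \<tau>2 / dist \<tau>1 \<tau>2 > norm f - \<epsilon>)"

definition eps_point :: "real \<Rightarrow> 'a::metric_space lip \<Rightarrow> 'a \<Rightarrow> bool" where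
  "eps_point \<epsilon> f t \<longleftrightarrow>
     (\<forall>U. t \<in> interior U \<longrightarrow> (\<exists>\<tau>1\<in>U. \<exists>\<tau>2\<in>U. \<tau>1 \<noteq> \<tau>2 \<and>
        lip_incr f \<tau>1 \<tau>2 / dist \<tau>1 \<tau>2 > norm f - \<epsilon>))"

definition spreadingly_local :: "'a::metric_space itself \<Rightarrow> bool" where
  "spreadingly_local TYPE('a) \<longleftrightarrow>
     (\<forall>\<epsilon>>0. \<forall>f :: 'a lip. infinite {t. eps_point \<epsilon> f t})"

end

theory Submission
  imports Defs
begin

text \<open>
  Let \<open>f\<close> span the range of a rank-one operator \<open>T = \<phi> \<otimes> f\<close>, with \<open>norm f = 1\<close>, and let \<open>g\<close>
  be a norm-one function at which \<open>\<phi>\<close> almost attains its norm.  It suffices to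
  replace \<open>g\<close> by some \<open>h\<close> of norm almost \<open>1\<close> with \<open>\<phi> h\<close> almost \<open>\<phi> g\<close> such that \<open>h\<close> has slope
  \<open>1\<close> along a pair of points where \<open>f\<close> has slope almost \<open>1\<close>: on that pair the slopes of \<open>h\<close>
  and \<open>T h = \<phi> h *\<^sub>R f\<close> add up to almost \<open>1 + norm T\<close>.

  Near an \<open>\<epsilon>\<close>-point of \<open>f\<close> one finds a steep pair of \<open>f\<close> whose two points are extremely close
  compared with the radius of a given ball.  Moving the value of \<open>g\<close> at one
  of them so that the slope becomes \<open>1\<close>, and keeping \<open>g\<close> off the ball, hardly increases the
  Lipschitz constant, and McShane's formula extends these values
  (\<open>steepen_in_ball\<close>).  The new function need not be close to \<open>g\<close>, but if
  the same is done in \<open>n\<close> disjoint balls, the \<open>n\<close> perturbations have disjoint supports and their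
  sum stays bounded, so that their average is \<open>O(1/n)\<close> and one of them is almost
  invisible to \<open>\<phi>\<close> (\<open>steep_approximant\<close>).  This is where infinitely many \<open>\<epsilon>\<close>-points
  are used.

  The two sufficient conditions both rest on the fact that a space (with at least two points) is
  spreadingly local as soon as every function has one \<open>\<epsilon>\<close>-point for each \<open>\<epsilon>\<close>
  (\<open>spreadingly_local_if_eps_points\<close>).  A logarithmic cutoff flattens \<open>f\<close> around a
  given point while raising local slopes elsewhere and lowering the norm by arbitrarily
  little (\<open>flatten_at_point\<close>), so finitely many steep points could be removed one after the other,
  leaving a function without any.  One \<open>\<epsilon>\<close>-point is found by bisecting a steep pair in the
  metrically convex case, and as a limit of shorter and shorter steep pairs in the compact case.
\<close>

section \<open>Increments and steep points\<close>

lemma lip_incr_split: "lip_incr f s t = lip_incr f s m + lip_incr f m t"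
  by transfer simp

lemma lip_incr_refl [simp]: "lip_incr f s s = 0"
  by transfer simp

lemma lip_incr_swap: "lip_incr f t s = - lip_incr f s t"
  by transfer simp

lemma lip_incr_sum: "lip_incr (sum F A) s t = (\<Sum>i\<in>A. lip_incr (F i) s t)"
  by (induction A rule: infinite_finite_induct) auto

lemma steep_pair_distinct:
  assumes "c * dist x y < lip_incr f x y"
  shows "x \<noteq> y"
  using assms by auto

text \<open>Working with an absolute level \<open>c\<close> instead of \<open>norm f - \<epsilon>\<close> lets one compare steep points of
  functions with different norms.\<close>

definition steep_at :: "real \<Rightarrow> 'a::metric_space lip \<Rightarrow> 'a \<Rightarrow> bool" where
  "steep_at c f p \<longleftrightarrow>
     (\<forall>r>0. \<exists>x\<in>ball p r. \<exists>y\<in>ball p r. c * dist x y < lip_incr f x y)"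

lemma eps_point_iff_steep_at: "eps_point \<epsilon> f p \<longleftrightarrow> steep_at (norm f - \<epsilon>) f p"
proof -
  have slope: "x \<noteq> y \<and> c < lip_incr f x y / dist x y \<longleftrightarrow> c * dist x y < lip_incr f x y"
    for c x y
    by (cases "x = y") (auto simp: pos_less_divide_eq)
  show ?thesis
    unfolding eps_point_def steep_at_def slope
  proof safe
    fix r :: real assume "r > 0" and
      *: "\<forall>U. p \<in> interior U \<longrightarrow>
            (\<exists>x\<in>U. \<exists>y\<in>U. (norm f - \<epsilon>) * dist x y < lip_incr f x y)"
    have "p \<in> interior (ball p r)" using \<open>r > 0\<close> by simp
    with * show "\<exists>x\<in>ball p r. \<exists>y\<in>ball p r. (norm f - \<epsilon>) * dist x y < lip_incr f x y"
      by blast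
  next
    fix U assume "p \<in> interior U" and
      *: "\<forall>r>0. \<exists>x\<in>ball p r. \<exists>y\<in>ball p r. (norm f - \<epsilon>) * dist x y < lip_incr f x y"
    then obtain r where "r > 0" "ball p r \<subseteq> U" unfolding mem_interior by blast
    with * show "\<exists>x\<in>U. \<exists>y\<in>U. (norm f - \<epsilon>) * dist x y < lip_incr f x y"
      by blast
  qed
qed

lemma steep_at_mono:
  assumes "steep_at c f p" "d \<le> c"
  shows "steep_at d f p"
proof -
  have "d * dist x y < lip_incr f x y" if "c * dist x y < lip_incr f x y" for x y
    using mult_right_mono[OF assms(2), of "dist x y"] that by simp
  then show ?thesis using assms(1) unfolding steep_at_def by meson
qed

lemma steep_pair_exists:
  fixes f :: "'a::metric_space lip"
  assumes "\<not> is_singleton (UNIV :: 'a set)" "c < norm f"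
  obtains x y where "c * dist x y < lip_incr f x y"
proof (rule ccontr)
  assume "\<not> thesis"
  then have le: "lip_incr f x y \<le> c * dist x y" for x y
    using that by (meson not_le)
  have abs: "\<bar>lip_incr f x y\<bar> \<le> c * dist x y" for x y
    using le[of x y] le[of y x] lip_incr_swap[of f x y] by (simp add: dist_commute)
  obtain a b :: 'a where "a \<noteq> b"
    using assms(1) by (metis UNIV_I UNIV_eq_I is_singletonI' empty_iff)
  have "0 \<le> c * dist a b" using abs[of a b] by linarith
  then have "c \<ge> 0" using \<open>a \<noteq> b\<close> by (simp add: zero_le_mult_iff)
  then have "norm f \<le> c" using abs by (intro norm_lip_le)
  with assms(2) show False by simp
qed

lemma steep_at_limit:
  assumes "s \<longlonglongrightarrow> p" "(\<lambda>n. dist (s n) (t n)) \<longlonglongrightarrow> 0"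
    and "\<forall>\<^sub>F n in sequentially. c * dist (s n) (t n) < lip_incr f (s n) (t n)"
  shows "steep_at c f p"
  unfolding steep_at_def
proof (intro allI impI)
  fix r :: real assume "r > 0"
  then have r: "0 < r / 2" by simp
  have "\<forall>\<^sub>F n in sequentially. dist (s n) p < r / 2"
    using tendstoD[OF assms(1) r] .
  moreover have "\<forall>\<^sub>F n in sequentially. dist (s n) (t n) < r / 2"
    using order_tendstoD(2)[OF assms(2) r] .
  ultimately have "\<forall>\<^sub>F n in sequentially. dist (s n) p < r \<and> dist (t n) p < r \<and>
      c * dist (s n) (t n) < lip_incr f (s n) (t n)"
    using assms(3)
  proof eventually_elim
    case (elim n)
    then show ?case using dist_triangle3[of "t n" p "s n"] r by simp
  qed
  then obtain n where "dist (s n) p < r" "dist (t n) p < r"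
    "c * dist (s n) (t n) < lip_incr f (s n) (t n)"
    unfolding eventually_sequentially by blast
  then show "\<exists>x\<in>ball p r. \<exists>y\<in>ball p r. c * dist x y < lip_incr f x y"
    by (metis dist_commute mem_ball)
qed

section \<open>Steepening a function in a small ball\<close>

text \<open>McShane's extension: the infimum of the cones \<open>h a + C * dist x a\<close> with apex over \<open>A\<close> is the
  largest \<open>C\<close>-Lipschitz function below \<open>h\<close> on \<open>A\<close>.\<close>

lemma mcshane_extension:
  fixes h :: "'a::metric_space \<Rightarrow> real"
  assumes "A \<noteq> {}" "C \<ge> 0"
    and lip: "\<And>a b. a \<in> A \<Longrightarrow> b \<in> A \<Longrightarrow> h a - h b \<le> C * dist a b"
  obtains H where "\<And>a. a \<in> A \<Longrightarrow> H a = h a" "\<And>x y. \<bar>H x - H y\<bar> \<le> C * dist x y"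
proof
  define H where "H x = (INF a\<in>A. h a + C * dist x a)" for x
  obtain a0 where a0: "a0 \<in> A" using assms(1) by blast
  have lower: "h a0 - C * dist x a0 \<le> h a + C * dist x a" if "a \<in> A" for a x
    using lip[OF a0 that] mult_left_mono[OF dist_triangle3[of a0 a x] \<open>C \<ge> 0\<close>]
    by (simp add: distrib_left)
  have bdd: "bdd_below ((\<lambda>a. h a + C * dist x a) ` A)" for x
    using lower by (intro bdd_belowI2[where m = "h a0 - C * dist x a0"])
  show "H a = h a" if "a \<in> A" for a
    unfolding H_def
  proof (rule antisym)
    show "(INF b\<in>A. h b + C * dist a b) \<le> h a"
      using cINF_lower[OF bdd that, of a] by simp
    show "h a \<le> (INF b\<in>A. h b + C * dist a b)"
      using lip[OF that] assms(1) by (intro cINF_greatest) (auto simp: algebra_simps)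
  qed
  have half: "H x - C * dist x y \<le> H y" for x y
    unfolding H_def[of y]
  proof (rule cINF_greatest[OF assms(1)])
    fix a assume "a \<in> A"
    have "H x \<le> h a + C * dist x a"
      unfolding H_def by (rule cINF_lower[OF bdd \<open>a \<in> A\<close>])
    moreover have "C * dist x a \<le> C * dist x y + C * dist y a"
      using mult_left_mono[OF dist_triangle[of x a y] \<open>C \<ge> 0\<close>] by (simp add: distrib_left)
    ultimately show "H x - C * dist x y \<le> h a + C * dist y a" by linarith
  qed
  show "\<bar>H x - H y\<bar> \<le> C * dist x y" for x y
    using half[of x y] half[of y x] by (simp add: dist_commute abs_le_iff)
qed

text \<open>Let \<open>x\<close> and \<open>y\<close> be a steep pair of \<open>f\<close> within \<open>\<delta>\<close> of \<open>p\<close>.  Keep \<open>g\<close> at \<open>x\<close> and off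
  \<open>ball p r\<close>, and prescribe the value \<open>g x + dist x y\<close> at \<open>y\<close>.  Against a point \<open>b\<close> off the ball,
  the new increment is at most \<open>dist x y + dist x b\<close>, which exceeds \<open>dist y b\<close> by at most
  \<open>2 * dist x y \<le> 4 * \<delta>\<close>; this is negligible relative to \<open>dist y b \<ge> r - \<delta>\<close>.\<close>

lemma steepen_in_ball:
  fixes f g :: "'a::metric_space lip"
  assumes steep: "steep_at c f p" and "norm g \<le> 1" "r > 0" "\<epsilon> > 0"
  obtains h x y where "norm h \<le> 1 + \<epsilon>" "c * dist x y < lip_incr f x y"
    "lip_incr h x y = dist x y"
    "\<And>s t. s \<notin> ball p r \<Longrightarrow> t \<notin> ball p r \<Longrightarrow> lip_incr h s t = lip_incr g s t"
proof -
  \<comment> \<open>The radius is chosen so that \<open>4 * \<delta> \<le> \<epsilon> * (r - \<delta>)\<close>.\<close>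
  define \<delta> where "\<delta> = \<epsilon> * r / (4 + \<epsilon>)"
  have "\<delta> > 0" and \<delta>: "4 * \<delta> = \<epsilon> * (r - \<delta>)" and "\<delta> < r"
    using assms(3,4) by (auto simp: \<delta>_def field_simps)
  obtain x y where x: "dist p x < \<delta>" and y: "dist p y < \<delta>"
    and f: "c * dist x y < lip_incr f x y"
    using steep \<open>\<delta> > 0\<close> unfolding steep_at_def by (meson mem_ball)
  have "x \<noteq> y" using f by (rule steep_pair_distinct)
  define A where "A = insert x (insert y (- ball p r))"
  define h where "h z = (if z = y then dist x y else lip_incr g x z)" for z
  have g: "\<bar>lip_incr g s t\<bar> \<le> dist s t" for s t
    using lip_incr_le[of g s t] mult_right_mono[OF assms(2) zero_le_dist[of s t]] by simp
  have pair: "h a - h b \<le> (1 + \<epsilon>) * dist a b" if "a \<noteq> y" "b \<noteq> y" for a b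
  proof -
    have "h a - h b = lip_incr g b a"
      using that lip_incr_split[of g x a b] by (simp add: h_def)
    also have "\<dots> \<le> dist b a" using g[of b a] by simp
    also have "\<dots> \<le> (1 + \<epsilon>) * dist a b"
      using assms(4) by (simp add: dist_commute distrib_right)
    finally show ?thesis .
  qed
  have near: "\<bar>h y - h b\<bar> \<le> (1 + \<epsilon>) * dist b y" if "b \<in> A" "b \<noteq> y" for b
  proof (cases "b = x")
    case True
    then show ?thesis using \<open>x \<noteq> y\<close> assms(4) by (simp add: h_def distrib_right)
  next
    case False
    then have "r \<le> dist p b" using that by (simp add: A_def)
    then have far: "r - \<delta> \<le> dist b y"
      using dist_triangle[of p b y] y by (simp add: dist_commute)
    have xy: "dist x y \<le> 2 * \<delta>"
      using dist_triangle3[of x y p] x y by (simp add: dist_commute)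
    have "\<bar>h y - h b\<bar> \<le> dist x y + dist x b"
      using g[of x b] abs_triangle_ineq4[of "dist x y" "lip_incr g x b"] that by (simp add: h_def)
    also have "\<dots> \<le> 4 * \<delta> + dist b y"
      using xy dist_triangle[of x b y] by (simp add: dist_commute)
    also have "\<dots> \<le> \<epsilon> * dist b y + dist b y"
      using mult_left_mono[OF far, of \<epsilon>] assms(4) by (simp add: \<delta>)
    finally show ?thesis by (simp add: distrib_right)
  qed
  have "h a - h b \<le> (1 + \<epsilon>) * dist a b" if "a \<in> A" "b \<in> A" for a b
    using pair[of a b] near[of a] near[of b] that
    by (cases "a = y"; cases "b = y") (auto simp: dist_commute)
  then obtain H where H: "\<And>a. a \<in> A \<Longrightarrow> H a = h a"
    "\<And>a b. \<bar>H a - H b\<bar> \<le> (1 + \<epsilon>) * dist a b"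
    using mcshane_extension[of A "1 + \<epsilon>" h] assms(4) unfolding A_def by auto
  obtain h' where h': "\<And>s t. lip_incr h' s t = H t - H s"
    using lip_incr_surj[OF lipschitz_funI[of "1 + \<epsilon>" H]] H(2) assms(4) by auto
  show ?thesis
  proof
    show "norm h' \<le> 1 + \<epsilon>"
      using H(2) assms(4) by (intro norm_lip_le) (auto simp: h' dist_commute abs_minus_commute)
    show "c * dist x y < lip_incr f x y" by (rule f)
    show "lip_incr h' x y = dist x y"
      using \<open>x \<noteq> y\<close> by (simp add: h' H A_def h_def)
    show "lip_incr h' s t = lip_incr g s t" if "s \<notin> ball p r" "t \<notin> ball p r" for s t
    proof -
      have "s \<noteq> y" "t \<noteq> y" using that y \<open>\<delta> < r\<close> by auto
      then show ?thesis
        using that lip_incr_split[of g x t s] by (simp add: h' H A_def h_def)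
    qed
  qed
qed

section \<open>Averaging over many balls\<close>

text \<open>An increment from \<open>s\<close> to \<open>t\<close> sees only the ball containing \<open>s\<close> and the ball containing \<open>t\<close>,
  so the bound does not depend on the number of summands.\<close>

lemma norm_sum_disjoint_supports_le:
  fixes u :: "'i \<Rightarrow> 'a::metric_space lip"
  assumes "finite I" and disj: "disjoint_family_on B I"
    and bound: "\<And>i. i \<in> I \<Longrightarrow> norm (u i) \<le> C"
    and supp: "\<And>i s t. i \<in> I \<Longrightarrow> s \<notin> B i \<Longrightarrow> t \<notin> B i \<Longrightarrow> lip_incr (u i) s t = 0"
    and "C \<ge> 0"
  shows "norm (\<Sum>i\<in>I. u i) \<le> 2 * C"
proof (rule norm_lip_le)
  fix s t :: 'a
  define J where "J z = {i \<in> I. z \<in> B i}" for z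
  have fin: "finite (J z)" for z using assms(1) by (simp add: J_def)
  have one: "card (J z) \<le> 1" for z
    unfolding card_le_Suc0_iff_eq[OF fin, of z, folded One_nat_def]
    using disj unfolding J_def disjoint_family_on_def by blast
  have "card (J s \<union> J t) \<le> 2"
    using card_Un_le[of "J s" "J t"] one[of s] one[of t] by linarith
  then have card: "real (card (J s \<union> J t)) \<le> 2" by linarith
  have "\<bar>lip_incr (\<Sum>i\<in>I. u i) s t\<bar> = \<bar>\<Sum>i\<in>J s \<union> J t. lip_incr (u i) s t\<bar>"
    unfolding lip_incr_sum
    by (rule arg_cong[where f = abs], rule sum.mono_neutral_right)
      (use assms(1) supp in \<open>auto simp: J_def\<close>)
  also have "\<dots> \<le> (\<Sum>i\<in>J s \<union> J t. \<bar>lip_incr (u i) s t\<bar>)" by (rule sum_abs)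
  also have "\<dots> \<le> real (card (J s \<union> J t)) * (C * dist s t)"
  proof (rule sum_bounded_above)
    fix i assume "i \<in> J s \<union> J t"
    then have "norm (u i) * dist s t \<le> C * dist s t"
      by (intro mult_right_mono bound) (auto simp: J_def)
    then show "\<bar>lip_incr (u i) s t\<bar> \<le> C * dist s t"
      using lip_incr_le[of "u i" s t] by linarith
  qed
  also have "\<dots> \<le> 2 * (C * dist s t)"
    using card \<open>C \<ge> 0\<close> by (intro mult_right_mono) auto
  finally show "\<bar>lip_incr (\<Sum>i\<in>I. u i) s t\<bar> \<le> 2 * C * dist s t" by simp
qed (use \<open>C \<ge> 0\<close> in simp)

lemma finite_disjoint_balls:
  fixes P :: "'a::metric_space set"
  assumes "finite P"
  obtains r where "r > 0" "disjoint_family_on (\<lambda>p. ball p r) P"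
proof -
  define D where "D = insert 1 ((\<lambda>(p, q). dist p q) ` {(p, q) \<in> P \<times> P. p \<noteq> q})"
  have "finite {(p, q) \<in> P \<times> P. p \<noteq> q}"
    by (rule finite_subset[of _ "P \<times> P"]) (use assms in auto)
  then have D: "finite D" "D \<noteq> {}" by (simp_all add: D_def)
  have pos: "Min D > 0" using Min_gr_iff[OF D, of 0] by (auto simp: D_def)
  show ?thesis
  proof
    show "Min D / 2 > 0" using pos by simp
    have False if "p \<in> P" "q \<in> P" "p \<noteq> q" "dist p z < Min D / 2" "dist q z < Min D / 2" for p q z
    proof -
      have "dist p q \<in> D" using that by (force simp: D_def)
      then have "Min D \<le> dist p q" using D by simp
      then show False using dist_triangle2[of p q z] that by linarith
    qed
    then show "disjoint_family_on (\<lambda>p. ball p (Min D / 2)) P"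
      unfolding disjoint_family_on_def by auto
  qed
qed

text \<open>The perturbations in \<open>n\<close> disjoint balls have a sum of norm at most \<open>C\<close>, whatever \<open>n\<close> is, so
  \<open>\<phi>\<close> takes a value of size \<open>O(1/n)\<close> on one of them.\<close>

lemma steep_approximant:
  fixes f g :: "'a::metric_space lip" and \<phi> :: "'a lip \<Rightarrow> real"
  assumes many: "infinite {p. steep_at c f p}" and "norm g \<le> 1"
    and "linear \<phi>" and bound: "\<And>u. \<bar>\<phi> u\<bar> \<le> K * norm u"
    and \<epsilon>: "0 < \<epsilon>"
  obtains h x y where "norm h \<le> 1 + \<epsilon>" "\<phi> g - \<epsilon> \<le> \<phi> h"
    "c * dist x y < lip_incr f x y" "lip_incr h x y = dist x y"
proof -
  interpret linear \<phi> by fact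
  define C where "C = 2 * (2 + \<epsilon>)"
  obtain n where n: "\<bar>K\<bar> * C < real n * \<epsilon>"
    using reals_Archimedean3[OF \<epsilon>] by blast
  obtain P where P: "finite P" "card P = n" "P \<subseteq> {p. steep_at c f p}"
    using infinite_arbitrarily_large[OF many] by blast
  obtain r where r: "r > 0" "disjoint_family_on (\<lambda>p. ball p r) P"
    using finite_disjoint_balls[OF P(1)] .
  have "\<exists>h x y. norm h \<le> 1 + \<epsilon> \<and> c * dist x y < lip_incr f x y \<and> lip_incr h x y = dist x y \<and>
      (\<forall>s t. s \<notin> ball p r \<longrightarrow> t \<notin> ball p r \<longrightarrow> lip_incr h s t = lip_incr g s t)" if p: "p \<in> P" for p
  proof -
    have "steep_at c f p" using p P(3) by blast
    from steepen_in_ball[OF this assms(2) r(1) \<epsilon>] show ?thesis by metis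
  qed
  then obtain h x y where h: "\<And>p. p \<in> P \<Longrightarrow> norm (h p) \<le> 1 + \<epsilon>"
    "\<And>p. p \<in> P \<Longrightarrow> c * dist (x p) (y p) < lip_incr f (x p) (y p)"
    "\<And>p. p \<in> P \<Longrightarrow> lip_incr (h p) (x p) (y p) = dist (x p) (y p)"
    "\<And>p s t. p \<in> P \<Longrightarrow> s \<notin> ball p r \<Longrightarrow> t \<notin> ball p r \<Longrightarrow> lip_incr (h p) s t = lip_incr g s t"
    by metis
  have "norm (\<Sum>p\<in>P. g - h p) \<le> C"
    unfolding C_def
  proof (rule norm_sum_disjoint_supports_le[OF P(1) r(2)])
    fix p assume "p \<in> P"
    then show "norm (g - h p) \<le> 2 + \<epsilon>"
      using norm_triangle_ineq4[of g "h p"] assms(2) h(1)[of p] by linarith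
  qed (use h(4) \<epsilon> in auto)
  then have "K * norm (\<Sum>p\<in>P. g - h p) \<le> \<bar>K\<bar> * C"
    by (intro mult_mono) auto
  then have "\<phi> (\<Sum>p\<in>P. g - h p) \<le> \<bar>K\<bar> * C"
    using bound[of "\<Sum>p\<in>P. g - h p"] by linarith
  with n have small: "(\<Sum>p\<in>P. \<phi> (g - h p)) < real n * \<epsilon>" by (simp add: sum)
  have "\<exists>p\<in>P. \<phi> (g - h p) < \<epsilon>"
  proof (rule ccontr)
    assume "\<not> ?thesis"
    then have "real (card P) * \<epsilon> \<le> (\<Sum>p\<in>P. \<phi> (g - h p))"
      by (intro sum_bounded_below) (auto simp: not_less)
    with small show False by (simp add: P(2))
  qed
  then obtain p where p: "p \<in> P" "\<phi> (g - h p) < \<epsilon>" by blast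
  show ?thesis
    using p h(1-3)[OF p(1)] by (intro that[of "h p" "x p" "y p"]) (auto simp: diff)
qed

lemma dim_1_imp_span_singleton:
  fixes V :: "'x::real_vector set"
  assumes "subspace V" "dim V = 1" "e \<in> V" "e \<noteq> 0" "v \<in> V"
  obtains k where "v = k *\<^sub>R e"
proof -
  obtain B where B: "B \<subseteq> V" "V \<subseteq> span B" "card B = 1"
    using real_vector.basis_exists[of V] assms(2) by metis
  then obtain b where "B = {b}" by (auto simp: card_1_singleton_iff)
  then have "e \<in> range (\<lambda>k. k *\<^sub>R b)" "v \<in> range (\<lambda>k. k *\<^sub>R b)"
    using B assms(3,5) by (auto simp: span_singleton)
  then obtain k l where k: "e = k *\<^sub>R b" and l: "v = l *\<^sub>R b" by blast
  have "k \<noteq> 0" using k assms(4) by auto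
  then have "v = (l / k) *\<^sub>R e" by (simp add: k l)
  then show ?thesis by (rule that)
qed

lemma spreadingly_local_imp_daugavet:
  assumes "spreadingly_local TYPE('a::complete_space)"
  shows "daugavet_property TYPE('a lip)"
  unfolding daugavet_property_def
proof (intro allI impI)
  fix T :: "'a lip \<Rightarrow>\<^sub>L 'a lip"
  assume rank: "dim (range T) = 1"
  have sub: "subspace (range T)"
    by (rule linear_subspace_image) (auto intro: bounded_linear.linear blinfun.bounded_linear_right)
  define M where "M = norm (id_blinfun + T)"
  have approx: "1 + (norm T - 2 * \<epsilon>) * (1 - \<epsilon>) \<le> (1 + \<epsilon>) * M"
    if \<epsilon>: "0 < \<epsilon>" "\<epsilon> < 1" "2 * \<epsilon> < norm T" for \<epsilon>
  proof -
    obtain u where u: "(norm T - \<epsilon>) * norm u < norm (T u)"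
    proof (rule ccontr)
      assume "\<not> thesis"
      then have "norm (T u) \<le> (norm T - \<epsilon>) * norm u" for u
        using that by (meson not_le)
      then have "norm T \<le> norm T - \<epsilon>" using \<epsilon> by (intro norm_blinfun_bound) auto
      with \<epsilon> show False by simp
    qed
    have "u \<noteq> 0" using u by (auto simp: blinfun.zero_right)
    define g where "g = u /\<^sub>R norm u"
    define f where "f = T g /\<^sub>R norm (T g)"
    have g: "norm g = 1" "norm T - \<epsilon> < norm (T g)"
      using u \<open>u \<noteq> 0\<close> by (auto simp: g_def blinfun.scaleR_right field_simps)
    have "norm (T g) > 0" using g(2) \<epsilon> by linarith
    then have f: "norm f = 1" "T g = norm (T g) *\<^sub>R f" by (simp_all add: f_def)
    have "f = T (g /\<^sub>R norm (T g))" by (simp add: f_def blinfun.scaleR_right)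
    then have "f \<in> range T" by simp
    moreover have "f \<noteq> 0" using f(1) by auto
    ultimately have "\<exists>k. T v = k *\<^sub>R f" for v
      using dim_1_imp_span_singleton[OF sub rank, of f "T v"] by blast
    then obtain \<phi> where \<phi>: "\<And>v. T v = \<phi> v *\<^sub>R f" by metis
    have "linear \<phi>"
    proof (rule linearI)
      fix a b and k :: real
      have "\<phi> (a + b) *\<^sub>R f = (\<phi> a + \<phi> b) *\<^sub>R f"
        by (metis \<phi> blinfun.add_right scaleR_left_distrib)
      then show "\<phi> (a + b) = \<phi> a + \<phi> b" using \<open>f \<noteq> 0\<close> by simp
      have "\<phi> (k *\<^sub>R a) *\<^sub>R f = (k * \<phi> a) *\<^sub>R f"
        by (metis \<phi> blinfun.scaleR_right scaleR_scaleR)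
      then show "\<phi> (k *\<^sub>R a) = k *\<^sub>R \<phi> a" using \<open>f \<noteq> 0\<close> by simp
    qed
    have bound: "\<bar>\<phi> v\<bar> \<le> norm T * norm v" for v
      using norm_blinfun[of T v] by (simp add: \<phi> f(1))
    have "\<phi> g *\<^sub>R f = norm (T g) *\<^sub>R f" using \<phi> f(2) by metis
    then have "\<phi> g = norm (T g)" using \<open>f \<noteq> 0\<close> by simp
    have "infinite {p. steep_at (1 - \<epsilon>) f p}"
      using assms \<epsilon>(1) f(1) unfolding spreadingly_local_def eps_point_iff_steep_at
      by (metis (no_types, lifting))
    then obtain h x y where h: "norm h \<le> 1 + \<epsilon>" "\<phi> g - \<epsilon> \<le> \<phi> h"
      "(1 - \<epsilon>) * dist x y < lip_incr f x y" "lip_incr h x y = dist x y"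
      using steep_approximant[OF _ eq_refl[OF g(1)] \<open>linear \<phi>\<close> bound \<epsilon>(1)] by blast
    have "x \<noteq> y" using h(3) by (rule steep_pair_distinct)
    have \<phi>h: "norm T - 2 * \<epsilon> \<le> \<phi> h" using h(2) g(2) \<open>\<phi> g = norm (T g)\<close> by linarith
    have "(1 + (norm T - 2 * \<epsilon>) * (1 - \<epsilon>)) * dist x y
        \<le> (1 + \<phi> h * (1 - \<epsilon>)) * dist x y"
      using \<phi>h \<epsilon> by (intro mult_right_mono add_left_mono) auto
    also have "\<dots> = dist x y + \<phi> h * ((1 - \<epsilon>) * dist x y)" by (simp add: algebra_simps)
    also have "\<dots> \<le> dist x y + \<phi> h * lip_incr f x y"
      using h(3) \<phi>h \<epsilon>(3) by (intro add_left_mono mult_left_mono) auto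
    also have "\<dots> = lip_incr ((id_blinfun + T) h) x y"
      by (simp add: blinfun.add_left \<phi> h(4))
    also have "\<dots> \<le> norm ((id_blinfun + T) h) * dist x y"
      using lip_incr_le[of "(id_blinfun + T) h" x y] by linarith
    finally have "1 + (norm T - 2 * \<epsilon>) * (1 - \<epsilon>) \<le> norm ((id_blinfun + T) h)"
      using \<open>x \<noteq> y\<close> by (simp add: mult_le_cancel_right)
    also have "\<dots> \<le> M * norm h" unfolding M_def by (rule norm_blinfun)
    also have "\<dots> \<le> M * (1 + \<epsilon>)" using h(1) by (intro mult_left_mono) (auto simp: M_def)
    finally show ?thesis by (simp add: mult.commute)
  qed
  have "norm T \<noteq> 0"
  proof
    assume "norm T = 0"
    then have "range T = {0}" by auto
    then show False using rank real_vector.dim_le_card[of "{0 :: 'a lip}" "{}"] by simp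
  qed
  then have "norm T > 0" by simp
  have "\<forall>\<^sub>F \<epsilon> in at_right 0. 1 + (norm T - 2 * \<epsilon>) * (1 - \<epsilon>) \<le> (1 + \<epsilon>) * M"
    unfolding eventually_at_right_field
    using approx \<open>norm T > 0\<close> by (intro exI[of _ "min 1 (norm T / 2)"]) auto
  moreover have "((\<lambda>\<epsilon>. 1 + (norm T - 2 * \<epsilon>) * (1 - \<epsilon>)) \<longlongrightarrow> 1 + (norm T - 2 * 0) * (1 - 0)) (at_right 0)"
    "((\<lambda>\<epsilon>. (1 + \<epsilon>) * M) \<longlongrightarrow> (1 + 0) * M) (at_right 0)"
    by (intro tendsto_intros)+
  ultimately have "1 + norm T \<le> M"
    using tendsto_le[OF trivial_limit_at_right_real] by fastforce
  moreover have "M \<le> 1 + norm T"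
    unfolding M_def
    using norm_triangle_ineq[of id_blinfun T] norm_blinfun_id_le[where 'a = "'a lip"] by linarith
  ultimately show "norm (id_blinfun + T) = 1 + norm T" by (simp add: M_def)
qed

section \<open>One steep point yields infinitely many\<close>

text \<open>The cutoff rises from \<open>0\<close> to \<open>1\<close> as \<open>\<rho>\<close> runs up to \<open>R\<close>, with derivative at most \<open>\<kappa> / \<rho>\<close>.  Since a
  Lipschitz function vanishing at a point is \<open>O(\<rho>)\<close> at distance \<open>\<rho>\<close>, multiplying it by the
  cutoff adds only \<open>O(\<kappa>)\<close> to its slopes.\<close>

definition log_cutoff :: "real \<Rightarrow> real \<Rightarrow> real \<Rightarrow> real" where
  "log_cutoff \<kappa> R \<rho> = max 0 (min 1 (1 + \<kappa> * ln (\<rho> / R)))"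

lemma log_cutoff_bounds: "0 \<le> log_cutoff \<kappa> R \<rho>" "log_cutoff \<kappa> R \<rho> \<le> 1"
  by (auto simp: log_cutoff_def)

lemma log_cutoff_eq_1:
  assumes "\<kappa> \<ge> 0" "0 < R" "R \<le> \<rho>"
  shows "log_cutoff \<kappa> R \<rho> = 1"
  using assms by (simp add: log_cutoff_def)

lemma log_cutoff_eq_0:
  assumes "\<kappa> > 0" "0 < R" "0 < \<rho>" "\<rho> \<le> R * exp (- 1 / \<kappa>)"
  shows "log_cutoff \<kappa> R \<rho> = 0"
proof -
  have "ln (\<rho> / R) \<le> ln (exp (- 1 / \<kappa>))"
    using assms by (intro ln_mono) (auto simp: divide_le_eq mult.commute)
  then have "\<kappa> * ln (\<rho> / R) \<le> \<kappa> * (- 1 / \<kappa>)"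
    using assms(1) by (intro mult_left_mono) auto
  then show ?thesis using assms(1) by (simp add: log_cutoff_def)
qed

lemma log_cutoff_diff_le:
  assumes "\<kappa> \<ge> 0" "0 < R" "0 < b" "b \<le> a"
  shows "b * \<bar>log_cutoff \<kappa> R a - log_cutoff \<kappa> R b\<bar> \<le> \<kappa> * (a - b)"
proof -
  have ln: "ln (a / R) - ln (b / R) = ln (a / b)"
    using assms by (simp add: ln_div)
  have "ln (a / b) \<ge> 0" using assms by simp
  then have "\<bar>log_cutoff \<kappa> R a - log_cutoff \<kappa> R b\<bar> \<le> \<bar>\<kappa> * ln (a / R) - \<kappa> * ln (b / R)\<bar>"
    unfolding log_cutoff_def by (auto simp: max_def min_def)
  also have "\<dots> = \<kappa> * ln (a / b)"
    unfolding right_diff_distrib[symmetric] ln using assms(1) \<open>ln (a / b) \<ge> 0\<close> by simp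
  also have "\<dots> \<le> \<kappa> * (a / b - 1)"
    using assms by (intro mult_left_mono ln_le_minus_one) auto
  finally have "b * \<bar>log_cutoff \<kappa> R a - log_cutoff \<kappa> R b\<bar> \<le> b * (\<kappa> * (a / b - 1))"
    using assms(3) by (intro mult_left_mono) auto
  also have "\<dots> = \<kappa> * (a - b)" using assms(3) by (simp add: field_simps)
  finally show ?thesis .
qed

text \<open>In the product rule the increment of the cutoff is multiplied by the value of the function at
  the endpoint nearer to \<open>t\<close>, where this value is small enough to offset the factor \<open>1 / \<rho>\<close> in
  the derivative of the cutoff.\<close>

lemma cutoff_product_increment_le:
  fixes u :: "'a::metric_space \<Rightarrow> real"
  assumes u: "\<bar>u x - u y\<bar> \<le> c * dist x y"
    and cone: "\<And>z. \<bar>u z\<bar> \<le> N * dist t z" and "N \<ge> 0" "\<kappa> \<ge> 0" "R > 0"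
  shows "\<bar>u x * log_cutoff \<kappa> R (dist t x) - u y * log_cutoff \<kappa> R (dist t y)\<bar>
    \<le> (c + N * \<kappa>) * dist x y"
  using u
proof (induction "dist t y" "dist t x" arbitrary: x y rule: linorder_wlog)
  case (sym x y)
  then show ?case
    by (metis abs_minus_commute dist_commute)
next
  case (le x y)
  let ?v = "\<lambda>z. log_cutoff \<kappa> R (dist t z)"
  have "\<bar>u y\<bar> * \<bar>?v x - ?v y\<bar> \<le> N * \<kappa> * dist x y"
  proof (cases "y = t")
    case True
    then have "u y = 0" using cone[of y] by simp
    then show ?thesis using assms(3,4) by simp
  next
    case False
    have "\<bar>u y\<bar> * \<bar>?v x - ?v y\<bar> \<le> (N * dist t y) * \<bar>?v x - ?v y\<bar>"
      by (intro mult_right_mono cone) auto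
    also have "\<dots> \<le> N * (\<kappa> * (dist t x - dist t y))"
      using log_cutoff_diff_le[of \<kappa> R "dist t y" "dist t x"] False le(1) assms(3-5)
      by (simp add: mult.assoc mult_left_mono)
    also have "\<dots> \<le> N * (\<kappa> * dist x y)"
      using dist_triangle[of t x y] assms(3,4)
      by (intro mult_left_mono) (auto simp: dist_commute)
    finally show ?thesis by simp
  qed
  moreover have "\<bar>u x - u y\<bar> * ?v x \<le> c * dist x y"
    using le(2) log_cutoff_bounds[of \<kappa> R "dist t x"]
      mult_left_mono[of "?v x" 1 "\<bar>u x - u y\<bar>"] by simp
  moreover have "\<bar>u x * ?v x - u y * ?v y\<bar> \<le> \<bar>(u x - u y) * ?v x\<bar> + \<bar>u y * (?v x - ?v y)\<bar>"
    using abs_triangle_ineq[of "(u x - u y) * ?v x" "u y * (?v x - ?v y)"]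
    by (simp add: algebra_simps)
  ultimately show ?case
    using log_cutoff_bounds(1)[of \<kappa> R "dist t x"] by (simp add: abs_mult distrib_right)
qed

text \<open>\<open>lip_incr f t\<close> is the representative of \<open>f\<close> vanishing at \<open>t\<close>.  Multiplied by the cutoff it becomes
  zero near \<open>t\<close>, so \<open>t\<close> is no longer steep, while a small \<open>R\<close> keeps the increment along a pair
  that almost realises the norm.\<close>

lemma flatten_at_point:
  fixes f :: "'a::metric_space lip"
  assumes "\<not> is_singleton (UNIV :: 'a set)" "c \<ge> 0" "\<eta> > 0"
  obtains g where "norm f - \<eta> \<le> norm g"
    "\<And>p. steep_at (c + \<eta>) g p \<Longrightarrow> p \<noteq> t \<and> steep_at c f p"
proof -
  obtain x0 y0 where xy: "(norm f - \<eta>) * dist x0 y0 < lip_incr f x0 y0"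
    using steep_pair_exists[OF assms(1), of "norm f - \<eta>" f] assms(3) by auto
  have "x0 \<noteq> y0" using xy by (rule steep_pair_distinct)
  \<comment> \<open>The cutoff must not touch the pair witnessing the norm, except possibly at \<open>t\<close> itself,
    where the function to be multiplied vanishes.\<close>
  define R where "R = (if x0 = t then dist t y0 else if y0 = t then dist t x0
    else min (dist t x0) (dist t y0))"
  have "R > 0" using \<open>x0 \<noteq> y0\<close> by (auto simp: R_def)
  define \<kappa> where "\<kappa> = \<eta> / (norm f + 1)"
  have "\<kappa> > 0" using assms(3) by (simp add: \<kappa>_def add_nonneg_pos)
  have \<kappa>: "norm f * \<kappa> \<le> \<eta>"
  proof -
    have "norm f / (norm f + 1) \<le> 1" by (simp add: divide_le_eq add_nonneg_pos)
    from mult_left_mono[OF this, of \<eta>] show ?thesis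
      using assms(3) by (simp add: \<kappa>_def mult.commute)
  qed
  define u where "u z = lip_incr f t z" for z
  define G where "G z = u z * log_cutoff \<kappa> R (dist t z)" for z
  have u_diff: "u x - u y = lip_incr f y x" for x y
    using lip_incr_split[of f t x y] by (simp add: u_def)
  have G_diff: "\<bar>G x - G y\<bar> \<le> (d + \<eta>) * dist x y" if "\<bar>u x - u y\<bar> \<le> d * dist x y" for d x y
  proof -
    have "\<bar>G x - G y\<bar> \<le> (d + norm f * \<kappa>) * dist x y"
      unfolding G_def using \<open>\<kappa> > 0\<close> \<open>R > 0\<close>
      by (intro cutoff_product_increment_le that) (auto simp: u_def lip_incr_le)
    also have "\<dots> \<le> (d + \<eta>) * dist x y" using \<kappa> by (intro mult_right_mono) auto
    finally show ?thesis .
  qed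
  have "\<bar>G x - G y\<bar> \<le> (norm f + \<eta>) * dist x y" for x y
    using lip_incr_le[of f y x] by (intro G_diff) (simp add: u_diff dist_commute)
  then obtain g where g: "\<And>x y. lip_incr g x y = G y - G x"
    using lip_incr_surj[OF lipschitz_funI[of "norm f + \<eta>" G]] assms(3) by auto
  show ?thesis
  proof
    have "G x0 = u x0" "G y0 = u y0"
      using \<open>\<kappa> > 0\<close> \<open>R > 0\<close> by (auto simp: G_def u_def R_def log_cutoff_eq_1)
    then have "lip_incr g x0 y0 = lip_incr f x0 y0" by (simp add: g u_diff)
    then have "(norm f - \<eta>) * dist x0 y0 \<le> norm g * dist x0 y0"
      using xy lip_incr_le[of g x0 y0] by linarith
    then show "norm f - \<eta> \<le> norm g" using \<open>x0 \<noteq> y0\<close> by simp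
  next
    fix p assume steep: "steep_at (c + \<eta>) g p"
    show "p \<noteq> t \<and> steep_at c f p"
    proof
      show "p \<noteq> t"
      proof
        assume "p = t"
        define \<delta> where "\<delta> = R * exp (- 1 / \<kappa>)"
        have "\<delta> > 0" using \<open>R > 0\<close> by (simp add: \<delta>_def)
        have zero: "G z = 0" if "dist t z < \<delta>" for z
        proof (cases "z = t")
          case False
          then show ?thesis
            using that \<open>\<kappa> > 0\<close> \<open>R > 0\<close> log_cutoff_eq_0[of \<kappa> R "dist t z"]
            by (simp add: G_def \<delta>_def)
        qed (simp add: G_def u_def)
        obtain x y where "dist t x < \<delta>" "dist t y < \<delta>" "(c + \<eta>) * dist x y < lip_incr g x y"
          using steep \<open>\<delta> > 0\<close> unfolding \<open>p = t\<close> steep_at_def by (meson mem_ball)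
        moreover have "0 \<le> (c + \<eta>) * dist x y" using assms(2,3) by simp
        ultimately show False by (simp add: g zero)
      qed
      show "steep_at c f p"
        unfolding steep_at_def
      proof (intro allI impI)
        fix r :: real assume "r > 0"
        then obtain x y where b: "x \<in> ball p r" "y \<in> ball p r"
          and "(c + \<eta>) * dist x y < lip_incr g x y"
          using steep unfolding steep_at_def by meson
        then have "\<not> \<bar>u y - u x\<bar> \<le> c * dist y x"
          using G_diff[of y x c] by (auto simp: g dist_commute)
        then have "c * dist x y < lip_incr f x y \<or> c * dist y x < lip_incr f y x"
          using lip_incr_swap[of f x y] by (auto simp: u_diff dist_commute abs_le_iff)
        with b show "\<exists>x\<in>ball p r. \<exists>y\<in>ball p r. c * dist x y < lip_incr f x y" by blast
      qed
    qed
  qed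
qed

text \<open>Flattening at a steep point of a function with finitely many of them leaves a function with
  fewer, and still of norm above the (slightly raised) level.\<close>

lemma infinite_steep_points:
  fixes f :: "'a::metric_space lip"
  assumes two: "\<not> is_singleton (UNIV :: 'a set)"
    and one: "\<And>(f :: 'a lip) \<epsilon>. \<epsilon> > 0 \<Longrightarrow> \<exists>p. eps_point \<epsilon> f p"
    and "0 \<le> c" "c < norm f"
  shows "infinite {p. steep_at c f p}"
proof
  assume "finite {p. steep_at c f p}"
  then show False
    using assms(3,4)
  proof (induction "card {p. steep_at c f p}" arbitrary: c f rule: less_induct)
    case (less c f)
    obtain t where t: "steep_at c f t"
      using one[of "norm f - c" f] less.prems by (auto simp: eps_point_iff_steep_at)
    define \<eta> where "\<eta> = (norm f - c) / 3"
    have "\<eta> > 0" using less.prems by (simp add: \<eta>_def)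
    obtain g where g: "norm f - \<eta> \<le> norm g"
      "\<And>p. steep_at (c + \<eta>) g p \<Longrightarrow> p \<noteq> t \<and> steep_at c f p"
      using flatten_at_point[OF two \<open>0 \<le> c\<close> \<open>\<eta> > 0\<close>, of f t] by metis
    have "{p. steep_at (c + \<eta>) g p} \<subset> {p. steep_at c f p}" using g(2) t by blast
    moreover from this have "finite {p. steep_at (c + \<eta>) g p}"
      using less.prems(1) by (meson finite_subset psubset_imp_subset)
    moreover have "c + \<eta> < norm g" using g(1) less.prems(3) by (simp add: \<eta>_def field_simps)
    moreover have "0 \<le> c + \<eta>" using less.prems(2) \<open>\<eta> > 0\<close> by simp
    ultimately show False
      using less.hyps[of "c + \<eta>" g] less.prems(1) psubset_card_mono by blast
  qed
qed

lemma exists_nonzero_lip: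
  assumes "\<not> is_singleton (UNIV :: 'a::metric_space set)"
  shows "\<exists>f :: 'a lip. f \<noteq> 0"
proof -
  obtain a b :: 'a where "a \<noteq> b"
    using assms by (metis UNIV_I UNIV_eq_I is_singletonI' empty_iff)
  have "lipschitz_fun (dist a)"
    by (rule lipschitz_funI[of 1])
      (use abs_dist_diff_le[of _ a] in \<open>simp_all add: dist_commute\<close>)
  then obtain f where "\<And>s t. lip_incr f s t = dist a t - dist a s"
    by (rule lip_incr_surj) blast
  then have "lip_incr f a b \<noteq> 0" using \<open>a \<noteq> b\<close> by simp
  then show ?thesis by (metis lip_incr_simps(1))
qed

lemma spreadingly_local_if_eps_points:
  assumes two: "\<not> is_singleton (UNIV :: 'a::metric_space set)"
    and one: "\<And>(f :: 'a lip) \<epsilon>. \<epsilon> > 0 \<Longrightarrow> \<exists>p. eps_point \<epsilon> f p"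
  shows "spreadingly_local TYPE('a)"
  unfolding spreadingly_local_def eps_point_iff_steep_at
proof (intro allI impI)
  fix \<epsilon> :: real and f :: "'a lip" assume "\<epsilon> > 0"
  show "infinite {p. steep_at (norm f - \<epsilon>) f p}"
  proof (cases "f = 0")
    case False
    define c where "c = max 0 (norm f - \<epsilon>)"
    have "infinite {p. steep_at c f p}"
      using False \<open>\<epsilon> > 0\<close> by (intro infinite_steep_points two one) (auto simp: c_def)
    then show ?thesis
      by (rule infinite_super[rotated]) (auto simp: c_def elim: steep_at_mono)
  next
    \<comment> \<open>Every accumulation point of the space is an \<open>\<epsilon>\<close>-point of \<open>0\<close>, and a steep point of any
      function is an accumulation point.\<close>
    case True
    obtain g :: "'a lip" where "g \<noteq> 0" using exists_nonzero_lip[OF two] by blast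
    then have "infinite {p. steep_at 0 g p}"
      by (intro infinite_steep_points two one) auto
    moreover have "steep_at (norm f - \<epsilon>) f p" if "steep_at 0 g p" for p
    proof -
      have "(norm f - \<epsilon>) * dist x y < lip_incr f x y" if "0 * dist x y < lip_incr g x y" for x y
        using steep_pair_distinct[OF that] True \<open>\<epsilon> > 0\<close> by simp
      then show ?thesis using that unfolding steep_at_def by meson
    qed
    ultimately show ?thesis
      by (elim infinite_super[rotated]) auto
  qed
qed

section \<open>Finding one steep point\<close>

text \<open>The slope between \<open>s\<close> and \<open>t\<close> is the average of the slopes of the two halves at a metric
  midpoint, so one half is as steep.\<close>

lemma bisect_steep_pair:
  fixes f :: "'a::metric_space lip"
  assumes "metrically_convex TYPE('a)" and steep: "c * dist s t < lip_incr f s t"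
  obtains s' t' where "c * dist s' t' < lip_incr f s' t'" "dist s' t' = dist s t / 2"
    "dist s s' \<le> dist s t / 2"
proof -
  have "cball s (dist s t / 2) \<inter> cball t (dist s t / 2) \<noteq> {}"
    using assms(1) unfolding metrically_convex_def by simp
  then obtain m where m: "dist s m \<le> dist s t / 2" "dist m t \<le> dist s t / 2"
    by (auto simp: dist_commute)
  have eq: "dist s m = dist s t / 2" "dist m t = dist s t / 2"
    using dist_triangle[of s t m] m by auto
  have "c * dist s m + c * dist m t = c * dist s t" by (simp add: eq)
  then have "c * dist s m < lip_incr f s m \<or> c * dist m t < lip_incr f m t"
    using steep lip_incr_split[of f s t m] by linarith
  then show ?thesis using that[of s m] that[of m t] eq by auto
qed

lemma metrically_convex_imp_eps_point:
  fixes f :: "'a::complete_space lip"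
  assumes two: "\<not> is_singleton (UNIV :: 'a set)" and conv: "metrically_convex TYPE('a)"
    and "\<epsilon> > 0"
  shows "\<exists>p. eps_point \<epsilon> f p"
proof -
  define c where "c = norm f - \<epsilon>"
  obtain s0 t0 where start: "c * dist s0 t0 < lip_incr f s0 t0"
    using steep_pair_exists[OF two, of c f] \<open>\<epsilon> > 0\<close> by (auto simp: c_def)
  define L where "L = dist s0 t0"
  define P where "P n z \<longleftrightarrow> c * dist (fst z) (snd z) < lip_incr f (fst z) (snd z) \<and>
    dist (fst z) (snd z) = L / 2 ^ n" for n :: nat and z
  have "\<exists>Z. \<forall>n. P n (Z n) \<and> dist (fst (Z n)) (fst (Z (Suc n))) \<le> L / 2 ^ n"
  proof (rule dependent_nat_choice)
    show "\<exists>z. P 0 z" using start by (intro exI[of _ "(s0, t0)"]) (simp add: P_def L_def)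
    fix z n assume "P n z"
    then obtain s' t' where *: "c * dist s' t' < lip_incr f s' t'" "dist s' t' = L / 2 ^ n / 2"
      "dist (fst z) s' \<le> L / 2 ^ n / 2"
      using bisect_steep_pair[OF conv, of c "fst z" "snd z" f] unfolding P_def by metis
    have "x / 2 \<le> x" if "0 \<le> x" for x :: real using that by simp
    moreover have "0 \<le> L / 2 ^ n" by (simp add: L_def)
    ultimately have "L / 2 ^ n / 2 \<le> L / 2 ^ n" by blast
    with *(3) have "dist (fst z) s' \<le> L / 2 ^ n" by (rule order_trans)
    with * show "\<exists>z'. P (Suc n) z' \<and> dist (fst z) (fst z') \<le> L / 2 ^ n"
      by (intro exI[of _ "(s', t')"]) (simp add: P_def mult.commute)
  qed
  then obtain Z where Z: "\<And>n. P n (Z n)" "\<And>n. dist (fst (Z n)) (fst (Z (Suc n))) \<le> L / 2 ^ n"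
    by metis
  define s where "s n = fst (Z n)" for n
  define t where "t n = snd (Z n)" for n
  have "Cauchy s"
  proof (rule metric_CauchyI)
    \<comment> \<open>The steps form a geometric series whose tail from \<open>N\<close> on sums to \<open>2 * L / 2 ^ N\<close>.\<close>
    have tail: "dist (s N) (s (N + k)) \<le> 2 * L / 2 ^ N - 2 * L / 2 ^ (N + k)" for N k
    proof (induction k)
      case (Suc k)
      have "dist (s N) (s (N + Suc k)) \<le> dist (s N) (s (N + k)) + dist (s (N + k)) (s (Suc (N + k)))"
        by (simp add: dist_triangle)
      also have "\<dots> \<le> (2 * L / 2 ^ N - 2 * L / 2 ^ (N + k)) + L / 2 ^ (N + k)"
        using Suc Z(2)[of "N + k"] by (intro add_mono) (auto simp: s_def)
      also have "\<dots> = 2 * L / 2 ^ N - 2 * L / 2 ^ (N + Suc k)" by simp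
      finally show ?case .
    qed simp
    fix e :: real assume "e > 0"
    have "(\<lambda>N. 4 * L * (1 / 2) ^ N) \<longlonglongrightarrow> 0"
      by (rule tendsto_mult_right_zero[OF LIMSEQ_realpow_zero]) auto
    then have "\<forall>\<^sub>F N in sequentially. 4 * L * (1 / 2) ^ N < e"
      using \<open>e > 0\<close> by (intro order_tendstoD(2)) auto
    then obtain N where N: "4 * L * (1 / 2) ^ N < e"
      using eventually_happens'[OF sequentially_bot] by blast
    have near: "dist (s N) (s m) \<le> 2 * L / 2 ^ N" if "m \<ge> N" for m
    proof -
      have "0 \<le> 2 * L / 2 ^ m" by (simp add: L_def)
      then show ?thesis using tail[of N "m - N"] that by simp
    qed
    show "\<exists>M. \<forall>m\<ge>M. \<forall>n\<ge>M. dist (s m) (s n) < e"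
    proof (intro exI[of _ N] allI impI)
      fix m n assume "m \<ge> N" "n \<ge> N"
      then have "dist (s m) (s n) \<le> 2 * L / 2 ^ N + 2 * L / 2 ^ N"
        using dist_triangle3[of "s m" "s n" "s N"] near[of m] near[of n] by linarith
      also have "\<dots> = 4 * L * (1 / 2) ^ N" by (simp add: power_one_over)
      also have "\<dots> < e" by (rule N)
      finally show "dist (s m) (s n) < e" .
    qed
  qed
  then obtain p where p: "s \<longlonglongrightarrow> p" using Cauchy_convergent convergent_def by blast
  have "(\<lambda>n. L * (1 / 2) ^ n) \<longlonglongrightarrow> 0"
    by (rule tendsto_mult_right_zero[OF LIMSEQ_realpow_zero]) auto
  then have "(\<lambda>n. dist (s n) (t n)) \<longlonglongrightarrow> 0"
    using Z(1) by (simp add: P_def s_def t_def power_one_over)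
  moreover have "c * dist (s n) (t n) < lip_incr f (s n) (t n)" for n
    using Z(1)[of n] unfolding P_def s_def t_def by blast
  ultimately have "steep_at c f p"
    by (intro steep_at_limit[OF p] always_eventually allI)
  then show ?thesis unfolding eps_point_iff_steep_at c_def by blast
qed

lemma compact_local_imp_eps_point:
  fixes f :: "'a::metric_space lip"
  assumes "compact (UNIV :: 'a set)" and loc: "local_space TYPE('a)" and "\<epsilon> > 0"
  shows "\<exists>p. eps_point \<epsilon> f p"
proof -
  define \<delta> where "\<delta> n = min \<epsilon> (inverse (real (Suc n)))" for n
  have \<delta>: "\<delta> n > 0" "\<delta> n \<le> \<epsilon>" "\<delta> n \<le> inverse (real (Suc n))" for n
    using \<open>\<epsilon> > 0\<close> by (auto simp: \<delta>_def)
  have "\<exists>s t. dist s t < \<delta> n \<and> (norm f - \<epsilon>) * dist s t < lip_incr f s t" for n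
  proof -
    obtain s t where st: "s \<noteq> t" "dist s t < \<delta> n" "norm f - \<delta> n < lip_incr f s t / dist s t"
      using loc \<delta>(1) unfolding local_space_def by meson
    have "norm f - \<epsilon> < lip_incr f s t / dist s t" using st(3) \<delta>(2)[of n] by linarith
    then show ?thesis using st by (auto simp: pos_less_divide_eq)
  qed
  then obtain s t where st: "\<And>n. dist (s n) (t n) < \<delta> n"
    "\<And>n. (norm f - \<epsilon>) * dist (s n) (t n) < lip_incr f (s n) (t n)"
    by metis
  obtain p and k :: "nat \<Rightarrow> nat" where k: "strict_mono k" "(s \<circ> k) \<longlonglongrightarrow> p"
    using assms(1) unfolding compact_def by (metis UNIV_I)
  have "(\<lambda>n. dist (s n) (t n)) \<longlonglongrightarrow> 0"
  proof (rule tendsto_sandwich[OF _ _ tendsto_const LIMSEQ_inverse_real_of_nat])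
    show "\<forall>\<^sub>F n in sequentially. dist (s n) (t n) \<le> inverse (real (Suc n))"
      using st(1) \<delta>(3) by (meson always_eventually less_imp_le order.trans)
  qed simp
  then have "(\<lambda>n. dist ((s \<circ> k) n) ((t \<circ> k) n)) \<longlonglongrightarrow> 0"
    using LIMSEQ_subseq_LIMSEQ[OF _ k(1)] by (fastforce simp: o_def)
  then have "steep_at (norm f - \<epsilon>) f p"
    using st(2) by (intro steep_at_limit[OF k(2)] always_eventually allI) auto
  then show ?thesis unfolding eps_point_iff_steep_at by blast
qed

theorem theorem3p1:
  assumes "\<not> is_singleton (UNIV :: 'a::complete_space set)"
  shows "(spreadingly_local TYPE('a) \<longrightarrow> daugavet_property TYPE('a lip)) \<and>
    (metrically_convex TYPE('a) \<longrightarrow> spreadingly_local TYPE('a)) \<and>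
    (compact (UNIV :: 'a set) \<and> local_space TYPE('a) \<longrightarrow> spreadingly_local TYPE('a))"
  using spreadingly_local_imp_daugavet spreadingly_local_if_eps_points[OF assms]
    metrically_convex_imp_eps_point[OF assms] compact_local_imp_eps_point
  by blast

end
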